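(* Every finite connected bipartite graph $G$ admits a $2$-labelling $\ell$ such that, writing $S_x = \{v \in V(G) : \rho_\ell(v) = x\}$, there is at most one value $x$ for which $S_x$ is not an independent set, and for that value the induced subgraph $G[S_x]$ consists of at most one star together with isolated vertices.
   Context: A $2$-labelling of a graph $G$ is a map $\ell: E(G) \to \{1,2\}$. For a vertex $v$, $\rho_\ell(v)$ denotes the product of the labels $\ell(uv)$ over all edges $uv$ incident to $v$ (the empty product being $1$). *)

theory Defs
  imports "Graph_Theory.Graph_Theory"
begin

text \<open>
  Simple graphs are the locale \<^locale>\<open>graph\<close> of the entry Graph_Theory: finite symmetric digraphs
  without loops and parallel arcs. The undirected edge \<open>uv\<close> is the doubleton \<open>{u, v}\<close>, which stands
  for the two opposite arcs between \<open>u\<close> and \<open>v\<close>; a label is thus assigned to the edge, not to an arc.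
\<close>

definition edges :: "('a, 'b) pre_digraph \<Rightarrow> 'a set set" where
  "edges G = {{u, v} | u v. (u, v) \<in> arcs_ends G}"

definition bipartite :: "('a, 'b) pre_digraph \<Rightarrow> bool" where
  "bipartite G \<longleftrightarrow> (\<exists>A B. verts G = A \<union> B \<and> A \<inter> B = {} \<and>
     arcs_ends G \<subseteq> A \<times> B \<union> B \<times> A)"

definition independent_set :: "('a, 'b) pre_digraph \<Rightarrow> 'a set \<Rightarrow> bool" where
  "independent_set G S \<longleftrightarrow> S \<subseteq> verts G \<and> (\<forall>u\<in>S. \<forall>v\<in>S. (u, v) \<notin> arcs_ends G)"

definition two_labelling :: "('a, 'b) pre_digraph \<Rightarrow> ('a set \<Rightarrow> nat) \<Rightarrow> bool" where
  "two_labelling G l \<longleftrightarrow> (\<forall>e\<in>edges G. l e \<in> {1, 2})"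

definition label_product :: "('a, 'b) pre_digraph \<Rightarrow> ('a set \<Rightarrow> nat) \<Rightarrow> 'a \<Rightarrow> nat" where
  "label_product G l v = (\<Prod>e | e \<in> edges G \<and> v \<in> e. l e)"

definition product_class :: "('a, 'b) pre_digraph \<Rightarrow> ('a set \<Rightarrow> nat) \<Rightarrow> nat \<Rightarrow> 'a set" where
  "product_class G l x = {v \<in> verts G. label_product G l v = x}"

definition star :: "('a, 'b) pre_digraph \<Rightarrow> bool" where
  "star H \<longleftrightarrow> (\<exists>n\<ge>1. complete_bipartite_digraph 1 n H)"

definition isolated_vertex :: "('a, 'b) pre_digraph \<Rightarrow> 'a \<Rightarrow> bool" where
  "isolated_vertex H v \<longleftrightarrow> v \<in> verts H \<and> (\<forall>u. (u, v) \<notin> arcs_ends H \<and> (v, u) \<notin> arcs_ends H)"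

text \<open>
  \<open>T\<close> is the vertex set of the star, empty if there is none. Isolation is meant in \<open>H\<close>, so there
  are no edges between \<open>T\<close> and the remaining vertices.
\<close>

definition at_most_one_star_and_isolated :: "('a, 'b) pre_digraph \<Rightarrow> bool" where
  "at_most_one_star_and_isolated H \<longleftrightarrow> (\<exists>T \<subseteq> verts H. (T = {} \<or> star (H \<restriction> T)) \<and>
     (\<forall>v \<in> verts H - T. isolated_vertex H v))"

end

theory Submission
  imports Defs
begin

text \<open>
  Labels in \<open>{1, 2}\<close> amount to choosing a set \<open>F\<close> of edges (those labelled 2), and the label product
  at \<open>v\<close> is then 2 to the number of edges of \<open>F\<close> at \<open>v\<close>. Let \<open>r\<close> be any vertex and \<open>A\<close> one side of
  the bipartition. Toggling \<open>F\<close> along walks from \<open>r\<close> changes one parity at a time, except at \<open>r\<close>,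
  so \<open>F\<close> can be chosen such that a vertex other than \<open>r\<close> has odd degree in \<open>F\<close> iff it lies in \<open>A\<close>.
  Two adjacent vertices with the same product then include \<open>r\<close>, so all such edges have the product
  of \<open>r\<close> and form a star centred at \<open>r\<close>.
\<close>

definition incidence :: "'a set set \<Rightarrow> 'a \<Rightarrow> nat" where
  "incidence F v = card {e \<in> F. v \<in> e}"

lemma finite_edges:
  assumes "finite (arcs G)"
  shows "finite (edges G)"
proof -
  have "edges G = (\<lambda>(u, v). {u, v}) ` arcs_ends G"
    by (auto simp: edges_def)
  then show ?thesis
    using assms by (simp add: arcs_ends_def)
qed

lemma label_product_eq_power:
  assumes "finite (edges G)" "F \<subseteq> edges G"
  shows "label_product G (\<lambda>e. if e \<in> F then 2 else 1) v = 2 ^ incidence F v"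
proof -
  have "label_product G (\<lambda>e. if e \<in> F then 2 else 1) v
      = (\<Prod>e \<in> {e \<in> edges G. v \<in> e} \<inter> F. 2)"
    unfolding label_product_def using assms(1) by (subst prod.inter_restrict) auto
  also have "{e \<in> edges G. v \<in> e} \<inter> F = {e \<in> F. v \<in> e}"
    using assms(2) by auto
  finally show ?thesis
    by (simp add: incidence_def)
qed

text \<open>Adding or removing \<open>e\<close> shifts the degree in \<open>F\<close> by one at the
  vertices of \<open>e\<close> and leaves it alone elsewhere.\<close>

lemma odd_incidence_toggle:
  assumes "finite F"
  shows "odd (incidence (if e \<in> F then F - {e} else insert e F) v) \<longleftrightarrow>
    odd (incidence F v) \<noteq> (v \<in> e)"
proof (cases "v \<in> e")
  case False
  then have "{f \<in> (if e \<in> F then F - {e} else insert e F). v \<in> f} = {f \<in> F. v \<in> f}"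
    by auto
  with False show ?thesis by (simp add: incidence_def)
next
  case True
  let ?S = "{f \<in> F. v \<in> f}"
  have S: "finite ?S" using assms by simp
  show ?thesis
  proof (cases "e \<in> F")
    case True
    have "{f \<in> F - {e}. v \<in> f} = ?S - {e}" by auto
    moreover have "card ?S = Suc (card (?S - {e}))"
      using card.remove[OF S, of e] True \<open>v \<in> e\<close> by simp
    ultimately show ?thesis using True \<open>v \<in> e\<close> by (simp add: incidence_def)
  next
    case False
    have "{f \<in> insert e F. v \<in> f} = insert e ?S" using \<open>v \<in> e\<close> by auto
    then show ?thesis using False S \<open>v \<in> e\<close> by (simp add: incidence_def)
  qed
qed

context graph
begin

text \<open>When the edges of a walk from \<open>r\<close> to \<open>v\<close> are toggled, each
  inner visit flips a parity twice, so only the two ends can change.\<close>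

lemma toggle_parity_reachable:
  assumes "r \<rightarrow>\<^sup>* v" "F \<subseteq> edges G"
  shows "\<exists>F' \<subseteq> edges G. \<forall>w. w \<noteq> r \<longrightarrow> (odd (incidence F' w) \<longleftrightarrow> odd (incidence F w) \<noteq> (w = v))"
  using assms
proof (induction arbitrary: F rule: reachable_induct)
  case base
  then show ?case by blast
next
  case (step x y)
  \<comment> \<open>The last edge of the walk is toggled first and the induction hypothesis is
    applied to the result; the two flips at \<open>x\<close> cancel and the one at \<open>y\<close>
    remains.\<close>
  let ?F = "if {x, y} \<in> F then F - {{x, y}} else insert {x, y} F"
  have "{x, y} \<in> edges G" using step.hyps by (auto simp: edges_def)
  then have "?F \<subseteq> edges G" using step.prems by auto
  then obtain F' where F': "F' \<subseteq> edges G"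
    and odd: "\<And>w. w \<noteq> r \<Longrightarrow> odd (incidence F' w) \<longleftrightarrow> odd (incidence ?F w) \<noteq> (w = x)"
    using step.IH by blast
  have "finite F" using step.prems finite_edges finite_subset finite_arcs by blast
  moreover have "x \<noteq> y" using step.hyps adj_not_same by blast
  ultimately have "\<forall>w. w \<noteq> r \<longrightarrow> (odd (incidence F' w) \<longleftrightarrow> odd (incidence F w) \<noteq> (w = y))"
    using odd odd_incidence_toggle[of F "{x, y}"] by auto
  with F' show ?case by blast
qed

text \<open>The vertices of \<open>T\<close> are added one by one, each by a walk from
  \<open>r\<close>. The parity at \<open>r\<close> stays free because the number of vertices of odd
  degree is always even.\<close>

lemma parity_subset_exists:
  assumes "connected G" "r \<in> verts G" "T \<subseteq> verts G"
  shows "\<exists>F \<subseteq> edges G. \<forall>v. v \<noteq> r \<longrightarrow> (odd (incidence F v) \<longleftrightarrow> v \<in> T)"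
proof -
  have "finite T" using assms(3) finite_subset finite_verts by blast
  then show ?thesis using assms(3)
  proof (induction T)
    case empty
    then show ?case by (intro exI[of _ "{}"]) (simp add: incidence_def)
  next
    case (insert t T)
    then obtain F where F: "F \<subseteq> edges G" "\<forall>v. v \<noteq> r \<longrightarrow> (odd (incidence F v) \<longleftrightarrow> v \<in> T)"
      by auto
    have "r \<rightarrow>\<^sup>*\<^bsub>mk_symmetric G\<^esub> t"
      using assms(1,2) insert.prems by (auto simp: connected_def strongly_connected_def)
    then have "r \<rightarrow>\<^sup>* t" using reachable_mk_symmetric_eq sym_arcs by blast
    from toggle_parity_reachable[OF this F(1)] F(2) insert.hyps(2) show ?case
      by (metis insert_iff)
  qed
qed

lemma graph_induce_subgraph:
  assumes "S \<subseteq> verts G"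
  shows "graph (G \<restriction> S)"
proof -
  interpret H: sym_digraph "G \<restriction> S"
    using assms by (intro induced_graph_imp_graph induced_induce)
  show ?thesis
    using assms finite_subset[OF assms] no_loops no_multi_arcs
    by unfold_locales auto
qed

end

lemma arcs_ends_induce_subgraph: "arcs_ends (G \<restriction> S) = arcs_ends G \<inter> S \<times> S"
  by (auto simp: arcs_ends_conv)

lemma induce_subgraph_induce_subgraph:
  assumes "T \<subseteq> S"
  shows "(G \<restriction> S) \<restriction> T = G \<restriction> T"
  using assms by (auto simp: induce_subgraph_def)

text \<open>The leaves are the neighbours of \<open>r\<close> in \<open>S\<close>; two of them are
  never adjacent, since such an edge would miss \<open>r\<close>.\<close>

lemma (in graph) at_most_one_star_centred:
  assumes S: "S \<subseteq> verts G"
    and centred: "\<And>u v. u \<in> S \<Longrightarrow> v \<in> S \<Longrightarrow> (u, v) \<in> arcs_ends G \<Longrightarrow> u = r \<or> v = r"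
  shows "at_most_one_star_and_isolated (G \<restriction> S)"
\<comment> \<open>A star needs at least one leaf, so a set without edges is treated separately, with
  no star at all.\<close>
proof (cases "independent_set G S")
  case True
  then show ?thesis
    unfolding at_most_one_star_and_isolated_def
    by (intro exI[of _ "{}"])
      (auto simp: isolated_vertex_def arcs_ends_induce_subgraph independent_set_def)
next
  case False
  have sym: "(u, v) \<in> arcs_ends G \<longleftrightarrow> (v, u) \<in> arcs_ends G" for u v
    using arcs_ends_symmetric[OF sym_arcs] by blast
  define N where "N = {u \<in> S. (r, u) \<in> arcs_ends G}"
  obtain u v where uv: "u \<in> S" "v \<in> S" "(u, v) \<in> arcs_ends G"
    using False S by (auto simp: independent_set_def)
  then have r: "r \<in> S" and N: "N \<noteq> {}"
    using centred[OF uv] sym by (auto simp: N_def)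
  have "finite N" using S finite_subset[OF _ finite_verts, of N] by (auto simp: N_def)
  then have card: "card N \<ge> 1" using N by (simp add: Suc_leI card_gt_0_iff)
  have sub: "insert r N \<subseteq> S" using r by (auto simp: N_def)
  have rN: "r \<notin> N" using adj_not_same by (auto simp: N_def)
  have "arcs_ends (G \<restriction> insert r N) = {r} \<times> N \<union> N \<times> {r}"
    using centred sub sym adj_not_same
    by (auto simp: arcs_ends_induce_subgraph N_def)
  then have "\<exists>U V. verts (G \<restriction> insert r N) = U \<union> V \<and> U \<inter> V = {} \<and> card U = 1 \<and>
      card V = card N \<and> arcs_ends (G \<restriction> insert r N) = U \<times> V \<union> V \<times> U"
    using rN by - (rule exI[of _ "{r}"], rule exI[of _ N], simp)
  moreover have "graph (G \<restriction> insert r N)"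
    using sub S by (intro graph_induce_subgraph) auto
  ultimately have "complete_bipartite_digraph 1 (card N) (G \<restriction> insert r N)"
    by (simp add: complete_bipartite_digraph_def)
  then have "star ((G \<restriction> S) \<restriction> insert r N)"
    using card sub by (auto simp: star_def induce_subgraph_induce_subgraph)
  \<comment> \<open>An edge at \<open>v\<close> inside \<open>S\<close> would have \<open>r\<close>
    as its other end and so put \<open>v\<close> into \<open>N\<close>.\<close>
  moreover have "isolated_vertex (G \<restriction> S) v" if "v \<in> S - insert r N" for v
    using that centred sym
    by (auto simp: isolated_vertex_def arcs_ends_induce_subgraph N_def)
  ultimately show ?thesis
    unfolding at_most_one_star_and_isolated_def using sub
    by (intro exI[of _ "insert r N"]) auto
qed

theorem theorem4p3:
  fixes G :: "('a, 'b) pre_digraph"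
  assumes "graph G" and "connected G" and "bipartite G"
  shows "\<exists>l. two_labelling G l \<and>
    (\<exists>\<^sub>\<le>\<^sub>1 x. \<not> independent_set G (product_class G l x)) \<and>
    (\<forall>x. \<not> independent_set G (product_class G l x) \<longrightarrow>
       at_most_one_star_and_isolated (G \<restriction> product_class G l x))"
proof -
  interpret graph G by fact
  \<comment> \<open>Connectedness includes that there is a vertex.\<close>
  obtain r where r: "r \<in> verts G"
    using \<open>connected G\<close> by (auto simp: connected_def strongly_connected_def mk_symmetric_def)
  obtain A B where AB: "verts G = A \<union> B" "A \<inter> B = {}" "arcs_ends G \<subseteq> A \<times> B \<union> B \<times> A"
    using \<open>bipartite G\<close> by (auto simp: bipartite_def)
  obtain F where F: "F \<subseteq> edges G" and odd: "\<And>v. v \<noteq> r \<Longrightarrow> odd (incidence F v) \<longleftrightarrow> v \<in> A"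
    using parity_subset_exists[OF \<open>connected G\<close> r, of A] AB(1) by auto
  define l :: "'a set \<Rightarrow> nat" where "l e = (if e \<in> F then 2 else 1)" for e
  have prod: "label_product G l v = 2 ^ incidence F v" for v
    using label_product_eq_power[OF finite_edges[OF finite_arcs] F] by (simp add: l_def[abs_def])
  have centred: "u = r \<or> v = r" if "(u, v) \<in> arcs_ends G"
    and "label_product G l u = label_product G l v" for u v
  proof (rule ccontr)
    assume "\<not> (u = r \<or> v = r)"
    \<comment> \<open>Equal powers of 2 have equal exponents, in particular of the same
      parity.\<close>
    then have "u \<in> A \<longleftrightarrow> v \<in> A" using odd that(2) prod
      by (metis power_inject_exp one_less_numeral_iff semiring_norm(76))
    then show False using that(1) AB by auto
  qed
  \<comment> \<open>An edge inside the class has \<open>r\<close> as an end, so \<open>r\<close>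
    itself lies in the class.\<close>
  have x: "x = label_product G l r" if dependent: "\<not> independent_set G (product_class G l x)" for x
  proof -
    obtain u v where "(u, v) \<in> arcs_ends G" "label_product G l u = x" "label_product G l v = x"
      using dependent unfolding independent_set_def product_class_def by blast
    with centred[of u v] show ?thesis by auto
  qed
  have "two_labelling G l" by (simp add: two_labelling_def l_def)
  moreover have "\<exists>\<^sub>\<le>\<^sub>1 x. \<not> independent_set G (product_class G l x)"
    using x by (auto intro!: Uniq_I)
  moreover have "at_most_one_star_and_isolated (G \<restriction> product_class G l x)" for x
    using centred by (intro at_most_one_star_centred[of _ r]) (auto simp: product_class_def)
  ultimately show ?thesis by blast
qed

end
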